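(* Let $n\ge 1$, let $Q\in\mathbb{R}^{n\times n}$ be a Stieltjes matrix, and let $a,c\in\mathbb{R}^n$. Consider the mixed-integer problem $$\text{(MIQO)}\qquad \min\ \{a^\top x+c^\top z+x^\top Qx:\ x\in\mathbb{R}^n,\ z\in\{0,1\}^n,\ x_i(1-z_i)=0\ \ \forall i\in[n]\}$$ and the convex problem $$\text{(SDP)}\qquad \begin{aligned}\min_{x,z,W,t}\ & a^\top x+c^\top z+t\\ \text{s.t. }& \begin{pmatrix}W&x\\ x^\top&t\end{pmatrix}\in\mathcal{S}_+^{n+1},\\ & W\le\sum_{k=1}^n R(\pi_k;S_{k-1}^\pi)\,z_{\pi_k}\ \text{ (entrywise) for all permutations }\pi\text{ of }[n],\\ & x\in\mathbb{R}^n,\ z\in[0,1]^n,\ t\in\mathbb{R}_+,\ W\in\mathbb{R}^{n\times n}.\end{aligned}$$ If $a\le 0$ or $a\ge 0$ (entrywise), then there exists an optimal solution $(x,z,W,t)$ of (SDP) such that $(x,z)$ is also optimal for (MIQO), with the same objective value.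
   Context: Write $[n]=\{1,\dots,n\}$. A Stieltjes matrix is a symmetric positive definite matrix $Q\in\mathbb{R}^{n\times n}$ with $Q_{ij}\le 0$ for all $i\ne j$. $\mathcal{S}_+^{m}$ denotes the cone of symmetric positive semidefinite $m\times m$ real matrices. For $S\subseteq[n]$, $e_S\in\{0,1\}^n$ is the indicator vector of $S$, and $Q_S^\star:=(Q\circ e_Se_S^\top)^\dagger\in\mathbb{R}^{n\times n}$, where $\circ$ is the entrywise product and $\dagger$ the Moore–Penrose pseudoinverse; equivalently, $Q_S^\star$ has $S\times S$ block equal to the inverse of the principal submatrix of $Q$ indexed by $S$ and all other entries $0$ (with $Q_\emptyset^\star=0$). For $S\subseteq[n]$ and $k\in[n]\setminus S$, let $R(k;S):=Q_{S\cup\{k\}}^\star-Q_S^\star\in\mathbb{R}^{n\times n}$. For a permutation $\pi=(\pi_1,\dots,\pi_n)$ of $[n]$, let $S_0^\pi=\emptyset$ and $S_k^\pi=\{\pi_1,\dots,\pi_k\}$ for $k\in[n]$. *)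

theory Defs
  imports "HOL-Analysis.Analysis"
begin

text \<open>
  The index set \<open>[n]\<close> is the finite type \<open>'n\<close>, so that \<open>n = CARD('n) \<ge> 1\<close>. The orders on
  \<open>real^'n\<close> and \<open>real^'n^'n\<close> are the entrywise ones (\<open>less_eq_vec_def\<close>), and \<open>*\<close> on matrices is
  the entrywise (Hadamard) product (\<open>times_vec_def\<close>).
\<close>

definition positive_definite :: "real^'n^'n \<Rightarrow> bool" where
  "positive_definite A \<longleftrightarrow> (\<forall>v. v \<noteq> 0 \<longrightarrow> 0 < v \<bullet> (A *v v))"

definition positive_semidefinite :: "real^'n^'n \<Rightarrow> bool" where
  "positive_semidefinite A \<longleftrightarrow> (\<forall>v. 0 \<le> v \<bullet> (A *v v))"

definition psd_cone :: "(real^'n^'n) set" where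
  "psd_cone = {A. transpose A = A \<and> positive_semidefinite A}"

definition stieltjes :: "real^'n^'n \<Rightarrow> bool" where
  "stieltjes Q \<longleftrightarrow>
     transpose Q = Q \<and> positive_definite Q \<and> (\<forall>i j. i \<noteq> j \<longrightarrow> Q $ i $ j \<le> 0)"

definition is_pseudoinverse :: "real^'n^'m \<Rightarrow> real^'m^'n \<Rightarrow> bool" where
  "is_pseudoinverse A X \<longleftrightarrow>
     A ** X ** A = A \<and> X ** A ** X = X \<and>
     transpose (A ** X) = A ** X \<and> transpose (X ** A) = X ** A"

definition pseudoinverse :: "real^'n^'m \<Rightarrow> real^'m^'n" where
  "pseudoinverse A = (THE X. is_pseudoinverse A X)"

definition ind :: "'n set \<Rightarrow> real^'n" where
  "ind S = (\<chi> i. if i \<in> S then 1 else 0)"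

definition restrict_mat :: "real^'n^'n \<Rightarrow> 'n set \<Rightarrow> real^'n^'n" where
  "restrict_mat Q S =
     Q * ((columnvector (ind S) :: real^1^'n) ** (rowvector (ind S) :: real^'n^1))"

definition Qstar :: "real^'n^'n \<Rightarrow> 'n set \<Rightarrow> real^'n^'n" where
  "Qstar Q S = pseudoinverse (restrict_mat Q S)"

definition R :: "real^'n^'n \<Rightarrow> 'n \<Rightarrow> 'n set \<Rightarrow> real^'n^'n" where
  "R Q k S = Qstar Q (S \<union> {k}) - Qstar Q S"

text \<open>
  A permutation \<open>(\<pi>\<^sub>1, \<dots>, \<pi>\<^sub>n)\<close> is an enumeration of the index type; only the values of the
  function on \<open>{1..n}\<close> matter. Its prefix \<open>S\<^sub>k\<close> is \<open>\<pi> ` {1..k}\<close>, which is empty for \<open>k = 0\<close>.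
\<close>

definition is_permutation :: "(nat \<Rightarrow> 'n::finite) \<Rightarrow> bool" where
  "is_permutation \<pi> \<longleftrightarrow> bij_betw \<pi> {1..CARD('n)} UNIV"

definition prefix_set :: "(nat \<Rightarrow> 'n) \<Rightarrow> nat \<Rightarrow> 'n set" where
  "prefix_set \<pi> k = \<pi> ` {1..k}"

text \<open>The \<open>(n+1) \<times> (n+1)\<close> matrix with blocks \<open>W\<close>, \<open>x\<close>, \<open>x\<^sup>T\<close>, \<open>t\<close>; the index \<open>None\<close> is the last one.\<close>

definition bordered ::
  "real^'n^'n \<Rightarrow> real^'n \<Rightarrow> real \<Rightarrow> real^('n option)^('n option)" where
  "bordered W x t = (\<chi> p q. case p of
       Some i \<Rightarrow> (case q of Some j \<Rightarrow> W $ i $ j | None \<Rightarrow> x $ i)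
     | None \<Rightarrow> (case q of Some j \<Rightarrow> x $ j | None \<Rightarrow> t))"

fun miqo_feasible :: "(real^'n) \<times> (real^'n) \<Rightarrow> bool" where
  "miqo_feasible (x, z) \<longleftrightarrow> (\<forall>i. z $ i \<in> {0, 1}) \<and> (\<forall>i. x $ i * (1 - z $ i) = 0)"

fun miqo_objective ::
  "real^'n^'n \<Rightarrow> real^'n \<Rightarrow> real^'n \<Rightarrow> (real^'n) \<times> (real^'n) \<Rightarrow> real" where
  "miqo_objective Q a c (x, z) = a \<bullet> x + c \<bullet> z + x \<bullet> (Q *v x)"

fun sdp_feasible :: "real^'n^'n \<Rightarrow> (real^'n) \<times> (real^'n) \<times> (real^'n^'n) \<times> real \<Rightarrow> bool" where
  "sdp_feasible Q (x, z, W, t) \<longleftrightarrow>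
     bordered W x t \<in> psd_cone \<and>
     (\<forall>\<pi>. is_permutation \<pi> \<longrightarrow>
        W \<le> (\<Sum>k = 1..CARD('n). z $ \<pi> k *\<^sub>R R Q (\<pi> k) (prefix_set \<pi> (k - 1)))) \<and>
     (\<forall>i. z $ i \<in> {0..1}) \<and> 0 \<le> t"

fun sdp_objective ::
  "real^'n \<Rightarrow> real^'n \<Rightarrow> (real^'n) \<times> (real^'n) \<times> (real^'n^'n) \<times> real \<Rightarrow> real" where
  "sdp_objective a c (x, z, W, t) = a \<bullet> x + c \<bullet> z + t"

text \<open>
  The description in \<open>pseudoinverse\<close> is well defined: the four Penrose conditions determine the
  matrix, and for the principal restrictions of a positive definite matrix a solution exists.
\<close>

lemma is_pseudoinverse_unique:
  assumes X: "is_pseudoinverse A X" and Y: "is_pseudoinverse A Y"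
  shows "X = Y"
proof -
  have AX: "A ** X = A ** Y"
  proof -
    have "A ** X = transpose (A ** Y ** A ** X)"
      using X Y by (simp add: is_pseudoinverse_def)
    also have "\<dots> = transpose (A ** X) ** transpose (A ** Y)"
      by (metis matrix_mul_assoc matrix_transpose_mul)
    also have "\<dots> = A ** X ** A ** Y"
      using X Y by (simp add: is_pseudoinverse_def matrix_mul_assoc)
    finally show ?thesis using X by (simp add: is_pseudoinverse_def)
  qed
  have XA: "X ** A = Y ** A"
  proof -
    have "X ** A = transpose (X ** (A ** Y ** A))"
      using X Y by (simp add: is_pseudoinverse_def)
    also have "\<dots> = transpose (Y ** A) ** transpose (X ** A)"
      by (metis matrix_mul_assoc matrix_transpose_mul)
    also have "\<dots> = Y ** (A ** X ** A)"
      using X Y unfolding is_pseudoinverse_def by (metis matrix_mul_assoc)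
    finally show ?thesis using X by (simp add: is_pseudoinverse_def)
  qed
  have "X = X ** A ** X" using X by (simp add: is_pseudoinverse_def)
  also have "\<dots> = Y ** A ** Y" using AX XA by (metis matrix_mul_assoc)
  also have "\<dots> = Y" using Y by (simp add: is_pseudoinverse_def)
  finally show ?thesis .
qed

lemma pseudoinverse_eqI: "is_pseudoinverse A X \<Longrightarrow> pseudoinverse A = X"
  unfolding pseudoinverse_def by (blast intro: is_pseudoinverse_unique)

lemma restrict_mat_nth:
  "restrict_mat Q S $ i $ j = (if i \<in> S \<and> j \<in> S then Q $ i $ j else 0)"
  by (simp add: restrict_mat_def columnvector_def rowvector_def ind_def matrix_matrix_mult_def)

lemma is_pseudoinverse_Qstar:
  fixes Q :: "real^'n^'n"
  assumes sym: "transpose Q = Q" and pd: "positive_definite Q"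
  shows "is_pseudoinverse (restrict_mat Q S) (Qstar Q S)"
proof -
  define B where "B = restrict_mat Q S"
  define D :: "real^'n^'n" where "D = (\<chi> i j. if i = j \<and> i \<notin> S then 1 else 0)"
  define M where "M = B + D"
  have Dv: "D *v v = (\<chi> i. if i \<in> S then 0 else v $ i)" for v
    by (simp add: D_def matrix_vector_mult_def vec_eq_iff if_distrib
        sum.delta if_distribR cong: if_cong)
  have Bv: "v \<bullet> (B *v v) = w \<bullet> (Q *v w)" if "w = (\<chi> i. if i \<in> S then v $ i else 0)" for v w
    unfolding that B_def
    by (auto simp: inner_vec_def matrix_vector_mult_def restrict_mat_nth sum_distrib_left
        intro!: sum.cong)
  have "v = 0" if "M *v v = 0" for v
  proof -
    define w where "w = (\<chi> i. if i \<in> S then v $ i else 0)"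
    have "v \<bullet> (M *v v) = w \<bullet> (Q *v w) + v \<bullet> (D *v v)"
      unfolding M_def by (simp add: matrix_vector_mult_add_rdistrib inner_add_right Bv[OF w_def])
    moreover have "v \<bullet> (D *v v) = (\<Sum>i\<in>UNIV. if i \<in> S then 0 else (v $ i)\<^sup>2)"
      by (auto simp: Dv inner_vec_def power2_eq_square intro!: sum.cong)
    moreover have "0 \<le> (\<Sum>i\<in>UNIV. if i \<in> S then 0 else (v $ i)\<^sup>2)"
      by (intro sum_nonneg) auto
    moreover have "0 \<le> w \<bullet> (Q *v w)" "w \<noteq> 0 \<Longrightarrow> 0 < w \<bullet> (Q *v w)"
      using pd by (cases "w = 0"; auto simp: positive_definite_def order.strict_implies_order)+
    ultimately have w0: "w = 0" and "(\<Sum>i\<in>UNIV. if i \<in> S then 0 else (v $ i)\<^sup>2) = 0"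
      using that by (force, force)
    then have "\<forall>i\<in>UNIV. (if i \<in> S then 0 else (v $ i)\<^sup>2) = 0"
      by (subst (asm) sum_nonneg_eq_0_iff) auto
    then show "v = 0"
      using w0 unfolding w_def by (auto simp: vec_eq_iff split: if_splits)
  qed
  then have "invertible M"
    using matrix_left_invertible_ker invertible_left_inverse by blast
  then obtain N where MN: "M ** N = mat 1" and NM: "N ** M = mat 1"
    unfolding invertible_def by blast
  have D_nth: "D $ i $ j = (if i = j \<and> i \<notin> S then 1 else 0)" for i j
    by (simp add: D_def)
  have BD: "B ** D = 0" "D ** B = 0"
    by (auto simp: B_def matrix_matrix_mult_def restrict_mat_nth D_nth vec_eq_iff intro!: sum.neutral)
  have DD: "D ** D = D"
  proof -
    have "(\<Sum>k\<in>UNIV. D $ i $ k * D $ k $ j) = D $ i $ j" for i j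
    proof -
      have "(\<Sum>k\<in>UNIV. D $ i $ k * D $ k $ j) = (\<Sum>k\<in>UNIV. if k = i then D $ i $ j else 0)"
        by (intro sum.cong) (auto simp: D_nth)
      then show ?thesis by simp
    qed
    then show ?thesis by (simp add: matrix_matrix_mult_def vec_eq_iff)
  qed
  have sub: "P ** (U - V) = P ** U - P ** V" "(U - V) ** P = U ** P - V ** P"
    for P U V :: "real^'n^'n"
    by (simp_all add: matrix_matrix_mult_def vec_eq_iff algebra_simps sum_subtractf)
  have B: "B = M - D" by (simp add: M_def)
  have MD: "M ** D = D" "D ** M = D"
    using BD DD unfolding B sub by simp_all
  have "D ** N = D ** M ** N" by (simp add: MD)
  then have DN: "D ** N = D" by (simp only: matrix_mul_assoc[symmetric] MN matrix_mul_rid)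
  have "N ** D = N ** (M ** D)" by (simp add: MD)
  then have ND: "N ** D = D" by (simp only: matrix_mul_assoc NM matrix_mul_lid)
  have "D $ i $ j = D $ j $ i" for i j
    by (auto simp: D_nth)
  then have "transpose (mat 1 - D) = mat 1 - D"
    by (auto simp: transpose_def vec_eq_iff mat_def)
  moreover have "B ** (N - D) = mat 1 - D" "(N - D) ** B = mat 1 - D"
    unfolding B by (simp_all add: sub MN NM DN ND DD MD)
  ultimately have "is_pseudoinverse B (N - D)"
    unfolding is_pseudoinverse_def
    by (simp add: sub BD DN DD)
  then show ?thesis
    unfolding Qstar_def B_def[symmetric] using pseudoinverse_eqI by metis
qed

end

theory Submission
  imports Defs
begin

text \<open>
  Minimising over \<open>x\<close> for a fixed support \<open>S\<close> turns (MIQO) into the minimisation over all \<open>S\<close> of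
  \<open>g S = c \<bullet> ind S - a \<bullet> (Qstar Q S *v a) / 4\<close>. For the lower bound on (SDP), test the bordered
  matrix with \<open>(a / 2, 1)\<close> and use \<open>a\<^sub>i a\<^sub>j \<ge> 0\<close> to insert the constraint of the permutation that
  sorts \<open>z\<close> decreasingly; Abel summation exhibits the result as a convex combination of values
  of \<open>g\<close>. Conversely, an optimal \<open>S\<close> gives the (SDP) point with \<open>z = ind S\<close>, \<open>W = Qstar Q S\<close>. It is
  feasible because \<open>S \<mapsto> Qstar Q S\<close> is entrywise supermodular: \<open>R Q k S\<close> is the rank-one matrix
  \<open>v v\<^sup>T / d\<close> of a bordered inversion, and the Stieltjes sign pattern makes \<open>v \<ge> 0\<close> increase and the
  Schur complement \<open>d > 0\<close> decrease as \<open>S\<close> grows.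
\<close>

section \<open>Principal inverses\<close>

text \<open>Describes \<open>Qstar Q S\<close> by entrywise equations that suit induction on
  \<open>S\<close>. The product with all of \<open>Q\<close> is harmless, since the rows of
  \<open>X\<close> outside \<open>S\<close> vanish.\<close>

definition principal_inverse :: "real^'n^'n \<Rightarrow> 'n set \<Rightarrow> real^'n^'n \<Rightarrow> bool" where
  "principal_inverse Q S X \<longleftrightarrow>
     transpose X = X \<and> (\<forall>i j. X $ i $ j \<noteq> 0 \<longrightarrow> i \<in> S \<and> j \<in> S) \<and>
     (\<forall>i\<in>S. \<forall>j\<in>S. (Q ** X) $ i $ j = (if i = j then 1 else 0))"

lemma transpose_eq_nth: "transpose X = X \<Longrightarrow> X $ i $ j = X $ j $ i"
  by (metis transpose_def vec_lambda_beta)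

lemma principal_inverse_nth_eq_0:
  "principal_inverse Q S X \<Longrightarrow> i \<notin> S \<or> j \<notin> S \<Longrightarrow> X $ i $ j = 0"
  unfolding principal_inverse_def by blast

lemma principal_inverse_mult_nth:
  assumes "principal_inverse Q S X" and "i \<in> S"
  shows "(Q ** X) $ i $ j = (if i = j then 1 else 0)"
proof (cases "j \<in> S")
  case False
  then show ?thesis
    using assms by (auto simp: matrix_matrix_mult_def principal_inverse_nth_eq_0)
qed (use assms in \<open>auto simp: principal_inverse_def\<close>)

lemma principal_inverse_mult_vec_nth:
  assumes X: "principal_inverse Q S X" and i: "i \<in> S"
  shows "(Q *v (X *v u)) $ i = u $ i"
proof -
  have "(Q *v (X *v u)) $ i = (\<Sum>j\<in>UNIV. (Q ** X) $ i $ j * u $ j)"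
    unfolding matrix_vector_mul_assoc by (simp add: matrix_vector_mult_def)
  also have "\<dots> = (\<Sum>j\<in>UNIV. if i = j then u $ j else 0)"
    by (intro sum.cong) (auto simp: principal_inverse_mult_nth[OF X i])
  finally show ?thesis by simp
qed

lemma principal_inverse_vec_nth_eq_0:
  "principal_inverse Q S X \<Longrightarrow> i \<notin> S \<Longrightarrow> (X *v u) $ i = 0"
  by (simp add: matrix_vector_mult_def principal_inverse_nth_eq_0)

text \<open>On the rows in \<open>S\<close> the product \<open>Q ** X\<close> acts as the identity;
  all other rows are killed by \<open>x\<close>.\<close>

lemma inner_principal_inverse:
  assumes X: "principal_inverse Q S X" and x: "\<And>i. i \<notin> S \<Longrightarrow> x $ i = 0"
  shows "x \<bullet> (Q *v (X *v u)) = x \<bullet> u"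
  unfolding inner_vec_def
proof (rule sum.cong)
  fix i :: 'a
  show "x $ i \<bullet> (Q *v (X *v u)) $ i = x $ i \<bullet> u $ i"
    by (cases "i \<in> S") (simp_all add: x principal_inverse_mult_vec_nth[OF X])
qed simp

lemma principal_inverse_quadratic_form:
  assumes X: "principal_inverse Q S X"
  shows "(X *v u) \<bullet> (Q *v (X *v u)) = u \<bullet> (X *v u)"
  using inner_principal_inverse[OF X principal_inverse_vec_nth_eq_0[OF X]]
  by (simp add: inner_commute)

lemma inner_symmetric_matrix:
  fixes A :: "real^'n^'n"
  assumes "transpose A = A"
  shows "u \<bullet> (A *v v) = v \<bullet> (A *v u)"
  by (metis assms dot_lmul_matrix inner_commute vector_transpose_matrix)

text \<open>Both products with \<open>X\<close> equal the coordinate projection \<open>D\<close>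
  onto \<open>S\<close>; the second follows from the first by transposing.\<close>

lemma is_pseudoinverse_principal_inverse:
  fixes Q :: "real^'n^'n"
  assumes sym: "transpose Q = Q" and X: "principal_inverse Q S X"
  shows "is_pseudoinverse (restrict_mat Q S) X"
proof -
  define D :: "real^'n^'n" where "D = (\<chi> i j. if i = j \<and> i \<in> S then 1 else 0)"
  have tX: "transpose X = X" using X by (simp add: principal_inverse_def)
  have tB: "transpose (restrict_mat Q S) = restrict_mat Q S"
    using transpose_eq_nth[OF sym] by (auto simp: transpose_def vec_eq_iff restrict_mat_nth)
  have tD: "transpose D = D"
    by (auto simp: transpose_def vec_eq_iff D_def)
  have BX: "restrict_mat Q S ** X = D"
  proof -
    have "(restrict_mat Q S ** X) $ i $ j = D $ i $ j" for i j
    proof (cases "i \<in> S")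
      case True
      have "(restrict_mat Q S ** X) $ i $ j = (Q ** X) $ i $ j"
        using True by (auto simp: matrix_matrix_mult_def restrict_mat_nth
            principal_inverse_nth_eq_0[OF X] intro!: sum.cong)
      then show ?thesis using True by (simp add: principal_inverse_mult_nth[OF X] D_def)
    qed (simp add: matrix_matrix_mult_def restrict_mat_nth D_def)
    then show ?thesis by (simp add: vec_eq_iff)
  qed
  have XB: "X ** restrict_mat Q S = D"
    using arg_cong[OF BX, of transpose] by (simp add: matrix_transpose_mul tX tB tD)
  have D_mult: "D ** A = A" if "\<And>i j. i \<notin> S \<Longrightarrow> A $ i $ j = 0" for A :: "real^'n^'n"
  proof -
    have "(\<Sum>k\<in>UNIV. D $ i $ k * A $ k $ j) = (\<Sum>k\<in>UNIV. if k = i then A $ i $ j else 0)" for i j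
      by (intro sum.cong) (auto simp: D_def that)
    then show ?thesis by (simp add: matrix_matrix_mult_def vec_eq_iff)
  qed
  show ?thesis
    unfolding is_pseudoinverse_def BX XB
    by (simp add: tD D_mult restrict_mat_nth principal_inverse_nth_eq_0[OF X])
qed

lemma Qstar_eqI: "transpose Q = Q \<Longrightarrow> principal_inverse Q S X \<Longrightarrow> Qstar Q S = X"
  unfolding Qstar_def by (intro pseudoinverse_eqI is_pseudoinverse_principal_inverse)

section \<open>Growing the index set by one element\<close>

lemma principal_inverse_empty: "principal_inverse Q {} 0"
  by (auto simp: principal_inverse_def transpose_def vec_eq_iff)

text \<open>Block elimination: e_k - Q_S^{-1} b, where b is the part of column \<open>k\<close> in
  \<open>S\<close>. The full column may stand here because \<open>X\<close> ignores entries outside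
  \<open>S\<close>.\<close>

definition elimination_vector :: "real^'n^'n \<Rightarrow> 'n \<Rightarrow> real^'n^'n \<Rightarrow> real^'n" where
  "elimination_vector Q k X = axis k 1 - X *v column k Q"

definition schur_complement :: "real^'n^'n \<Rightarrow> 'n \<Rightarrow> real^'n^'n \<Rightarrow> real" where
  "schur_complement Q k X = Q $ k $ k - column k Q \<bullet> (X *v column k Q)"

definition rank_one_update :: "real^'n^'n \<Rightarrow> 'n \<Rightarrow> real^'n^'n \<Rightarrow> real^'n^'n" where
  "rank_one_update Q k X = (\<chi> i j.
     elimination_vector Q k X $ i * elimination_vector Q k X $ j / schur_complement Q k X)"

context
  fixes Q X :: "real^'n^'n" and S :: "'n set" and k :: 'n
  assumes sym: "transpose Q = Q" and pd: "positive_definite Q"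
    and X: "principal_inverse Q S X" and k: "k \<notin> S"
begin

lemma elimination_vector_nth_self: "elimination_vector Q k X $ k = 1"
  by (simp add: elimination_vector_def principal_inverse_vec_nth_eq_0[OF X k])

lemma elimination_vector_nth_eq_0: "i \<notin> insert k S \<Longrightarrow> elimination_vector Q k X $ i = 0"
  by (simp add: elimination_vector_def principal_inverse_vec_nth_eq_0[OF X] axis_def)

lemma Q_elimination_vector:
  "Q *v elimination_vector Q k X = column k Q - Q *v (X *v column k Q)"
  by (simp add: elimination_vector_def matrix_vector_mult_diff_distrib matrix_vector_mult_basis)

text \<open>Up to the factor 1/d this vector is column \<open>k\<close> of the inverse on
  \<open>insert k S\<close>: elimination cancels the rows in \<open>S\<close>, and by symmetry of
  \<open>Q\<close> row \<open>k\<close> keeps the Schur complement d.\<close>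

lemma Q_elimination_vector_nth:
  assumes "i \<in> insert k S"
  shows "(Q *v elimination_vector Q k X) $ i = (if i = k then schur_complement Q k X else 0)"
proof (cases "i = k")
  case True
  have "(Q *v (X *v column k Q)) $ k = column k Q \<bullet> (X *v column k Q)"
    unfolding matrix_vector_mult_def[of Q] inner_vec_def
    using transpose_eq_nth[OF sym] by (auto simp: column_def intro!: sum.cong)
  then show ?thesis using True by (simp add: Q_elimination_vector schur_complement_def column_def)
next
  case False
  then show ?thesis
    using assms by (simp add: Q_elimination_vector principal_inverse_mult_vec_nth[OF X])
qed

text \<open>The Schur complement is the quadratic form of \<open>Q\<close> at the elimination
  vector, which is nonzero because its entry at \<open>k\<close> is 1.\<close>

lemma schur_complement_pos: "0 < schur_complement Q k X"
proof -
  let ?v = "elimination_vector Q k X"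
  have "?v \<bullet> (Q *v ?v) = (\<Sum>i\<in>UNIV. if i = k then schur_complement Q k X else 0)"
    unfolding inner_vec_def
  proof (rule sum.cong)
    fix i
    show "?v $ i \<bullet> (Q *v ?v) $ i = (if i = k then schur_complement Q k X else 0)"
      by (cases "i \<in> insert k S")
        (auto simp: Q_elimination_vector_nth elimination_vector_nth_self
          elimination_vector_nth_eq_0)
  qed simp
  moreover have "?v \<noteq> 0"
    using elimination_vector_nth_self by (metis zero_index zero_neq_one)
  ultimately show ?thesis using pd[unfolded positive_definite_def, rule_format, of ?v] by simp
qed

lemma principal_inverse_insert: "principal_inverse Q (insert k S) (X + rank_one_update Q k X)"
proof -
  let ?v = "elimination_vector Q k X" and ?d = "schur_complement Q k X"
  have d: "?d \<noteq> 0" using schur_complement_pos by simp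
  have QU: "(Q ** (X + rank_one_update Q k X)) $ i $ j
      = (Q ** X) $ i $ j + (Q *v ?v) $ i * ?v $ j / ?d" for i j
    by (simp add: matrix_matrix_mult_def matrix_vector_mult_def rank_one_update_def
        distrib_left sum.distrib sum_distrib_right sum_divide_distrib mult.assoc)
  have tX: "transpose X = X" using X by (simp add: principal_inverse_def)
  \<comment> \<open>Away from \<open>k\<close>, row \<open>k\<close> of \<open>Q ** X\<close> is the
    negated elimination vector. The rank-one term adds that vector in row \<open>k\<close>, which
    leaves a unit row.\<close>
  have QX_k: "(Q ** X) $ k $ j = (if j = k then 0 else - ?v $ j)" for j
  proof -
    have "(Q ** X) $ k $ j = (X *v column k Q) $ j"
      unfolding matrix_matrix_mult_def matrix_vector_mult_def column_def vec_lambda_beta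
      by (intro sum.cong refl)
        (metis transpose_eq_nth[OF sym] transpose_eq_nth[OF tX] mult.commute)
    then show ?thesis
      using principal_inverse_vec_nth_eq_0[OF X k] by (auto simp: elimination_vector_def axis_def)
  qed
  have "(Q ** (X + rank_one_update Q k X)) $ i $ j = (if i = j then 1 else 0)"
    if "i \<in> insert k S" for i j
  proof (cases "i = k")
    case True
    then show ?thesis
      using d elimination_vector_nth_self by (auto simp: QU QX_k Q_elimination_vector_nth)
  next
    case False
    then show ?thesis
      using that by (simp add: QU Q_elimination_vector_nth principal_inverse_mult_nth[OF X])
  qed
  moreover have "transpose (X + rank_one_update Q k X) = X + rank_one_update Q k X"
    unfolding transpose_def vec_eq_iff rank_one_update_def
    by (simp add: transpose_eq_nth[OF tX] mult.commute)
  moreover have "(X + rank_one_update Q k X) $ i $ j = 0"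
    if "i \<notin> insert k S \<or> j \<notin> insert k S" for i j
    using that by (auto simp: rank_one_update_def principal_inverse_nth_eq_0[OF X]
        elimination_vector_nth_eq_0)
  ultimately show ?thesis unfolding principal_inverse_def by blast
qed

end

text \<open>Insertions starting from the empty set reach every \<open>S\<close>; uniqueness of the
  pseudoinverse identifies the matrix so built.\<close>

lemma principal_inverse_Qstar:
  fixes Q :: "real^'n^'n"
  assumes sym: "transpose Q = Q" and pd: "positive_definite Q"
  shows "principal_inverse Q S (Qstar Q S)"
proof -
  have "\<exists>X. principal_inverse Q S X"
    using finite[of S]
    by (induction S rule: finite_induct)
      (use principal_inverse_empty principal_inverse_insert[OF sym pd] in blast)+
  then show ?thesis using Qstar_eqI[OF sym] by auto
qed

lemma Qstar_empty: "transpose Q = Q \<Longrightarrow> Qstar Q {} = 0"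
  by (intro Qstar_eqI principal_inverse_empty)

lemma Qstar_insert: "Qstar Q (insert k S) = Qstar Q S + R Q k S"
  by (simp add: R_def)

lemma R_eq_rank_one_update:
  assumes "transpose Q = Q" and "positive_definite Q" and "k \<notin> S"
  shows "R Q k S = rank_one_update Q k (Qstar Q S)"
proof -
  have "Qstar Q (insert k S) = Qstar Q S + rank_one_update Q k (Qstar Q S)"
    using assms by (intro Qstar_eqI principal_inverse_insert principal_inverse_Qstar)
  then show ?thesis by (simp add: R_def)
qed

lemma Qstar_psd:
  assumes "transpose Q = Q" and pd: "positive_definite Q"
  shows "0 \<le> u \<bullet> (Qstar Q S *v u)"
proof -
  have "0 \<le> w \<bullet> (Q *v w)" for w
    using pd by (cases "w = 0") (auto simp: positive_definite_def less_imp_le)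
  then show ?thesis
    by (metis principal_inverse_quadratic_form principal_inverse_Qstar assms)
qed

section \<open>Supermodularity\<close>

text \<open>Restricted to the support of \<open>X\<close>, the column of index \<open>k\<close> of \<open>Q\<close> is nonpositive, because its
  positive diagonal entry lies outside.\<close>

lemma elimination_vector_mono:
  fixes Q :: "real^'n^'n"
  assumes Q: "\<And>i j. i \<noteq> j \<Longrightarrow> Q $ i $ j \<le> 0"
    and XY: "X \<le> Y" and Y: "principal_inverse Q B Y" and X: "principal_inverse Q A X"
    and k: "k \<notin> A" "k \<notin> B"
  shows "elimination_vector Q k X \<le> elimination_vector Q k Y"
    and "schur_complement Q k Y \<le> schur_complement Q k X"
proof -
  have nth: "X $ i $ j * Q $ j $ k \<ge> Y $ i $ j * Q $ j $ k" for i j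
    using XY Q[of j k] k principal_inverse_nth_eq_0[OF X, of i j]
      principal_inverse_nth_eq_0[OF Y, of i j]
    by (cases "j = k") (auto simp: less_eq_vec_def intro!: mult_right_mono_neg)
  have le: "(Y *v column k Q) $ i \<le> (X *v column k Q) $ i" for i
    unfolding matrix_vector_mult_def column_def using nth by (auto intro!: sum_mono)
  then show "elimination_vector Q k X \<le> elimination_vector Q k Y"
    by (simp add: elimination_vector_def less_eq_vec_def)
  \<comment> \<open>Multiplying once more by the nonpositive entries of the column reverses the
    order again, so the term subtracted in the Schur complement grows.\<close>
  have "column k Q $ i * (X *v column k Q) $ i \<le> column k Q $ i * (Y *v column k Q) $ i" for i
    using le[of i] Q[of i k] principal_inverse_vec_nth_eq_0[OF X k(1)]
      principal_inverse_vec_nth_eq_0[OF Y k(2)]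
    by (cases "i = k") (auto simp: column_def intro!: mult_left_mono_neg)
  then show "schur_complement Q k Y \<le> schur_complement Q k X"
    by (auto simp: schur_complement_def inner_vec_def intro!: sum_mono)
qed

text \<open>Comparison with the empty set, whose elimination vector is the unit vector at
  \<open>k\<close>.\<close>

lemma elimination_vector_nonneg:
  fixes Q :: "real^'n^'n"
  assumes Q: "\<And>i j. i \<noteq> j \<Longrightarrow> Q $ i $ j \<le> 0"
    and X: "principal_inverse Q S X" and "0 \<le> X" and k: "k \<notin> S"
  shows "0 \<le> elimination_vector Q k X"
proof -
  have "0 \<le> elimination_vector Q k 0"
    by (simp add: elimination_vector_def less_eq_vec_def axis_def)
  also have "\<dots> \<le> elimination_vector Q k X"
    using elimination_vector_mono(1)[OF Q \<open>0 \<le> X\<close> X principal_inverse_empty] k by simp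
  finally show ?thesis .
qed

context
  fixes Q :: "real^'n^'n"
  assumes Q: "stieltjes Q"
begin

lemma stieltjes_sym: "transpose Q = Q" and stieltjes_pd: "positive_definite Q"
  and stieltjes_off_diagonal: "\<And>i j. i \<noteq> j \<Longrightarrow> Q $ i $ j \<le> 0"
  using Q by (auto simp: stieltjes_def)

text \<open>Nonnegativity of \<open>Qstar Q S\<close> is assumed because this is the induction step
  by which it is proved.\<close>

lemma R_nonneg_if_Qstar_nonneg:
  assumes "0 \<le> Qstar Q S" and "k \<notin> S"
  shows "0 \<le> R Q k S"
proof -
  note pi = principal_inverse_Qstar[OF stieltjes_sym stieltjes_pd]
  show ?thesis
    using elimination_vector_nonneg[OF stieltjes_off_diagonal pi assms]
      schur_complement_pos[OF stieltjes_sym stieltjes_pd pi assms(2)] assms(2)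
    by (simp add: R_eq_rank_one_update[OF stieltjes_sym stieltjes_pd] rank_one_update_def
        less_eq_vec_def)
qed

lemma Qstar_nonneg: "0 \<le> Qstar Q S"
  using finite[of S]
  by (induction S rule: finite_induct)
    (auto simp: Qstar_empty[OF stieltjes_sym] Qstar_insert R_nonneg_if_Qstar_nonneg
      intro: add_nonneg_nonneg)

lemma Qstar_mono:
  assumes "A \<subseteq> B"
  shows "Qstar Q A \<le> Qstar Q B"
proof -
  have "Qstar Q A \<le> Qstar Q (A \<union> C)" for C
    using finite[of C]
  proof (induction C rule: finite_induct)
    case (insert k C)
    show ?case
    proof (cases "k \<in> A")
      case False
      then have "0 \<le> R Q k (A \<union> C)"
        using insert by (intro R_nonneg_if_Qstar_nonneg Qstar_nonneg) auto
      then show ?thesis using insert.IH by (simp add: Qstar_insert add_increasing2)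
    qed (use insert in \<open>auto simp: insert_absorb\<close>)
  qed simp
  from this[of B] show ?thesis using assms by (simp add: Un_absorb1)
qed

text \<open>Supermodularity of \<open>Qstar Q\<close>: passing from \<open>A\<close> to
  \<open>B\<close> raises both nonnegative factors of the numerator and lowers the positive
  denominator.\<close>

lemma R_mono:
  assumes AB: "A \<subseteq> B" and k: "k \<notin> B"
  shows "R Q k A \<le> R Q k B"
proof -
  have kA: "k \<notin> A" using assms by auto
  note pi = principal_inverse_Qstar[OF stieltjes_sym stieltjes_pd]
  note mono = elimination_vector_mono[OF stieltjes_off_diagonal Qstar_mono[OF AB] pi pi kA k]
  have "0 \<le> elimination_vector Q k (Qstar Q A)"
    using elimination_vector_nonneg[OF stieltjes_off_diagonal pi Qstar_nonneg kA] .
  moreover have "0 < schur_complement Q k (Qstar Q B)"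
    using schur_complement_pos[OF stieltjes_sym stieltjes_pd pi k] .
  ultimately show ?thesis
    using mono
    unfolding R_eq_rank_one_update[OF stieltjes_sym stieltjes_pd kA]
      R_eq_rank_one_update[OF stieltjes_sym stieltjes_pd k]
    by (auto simp: rank_one_update_def less_eq_vec_def intro!: frac_le mult_mono
        intro: mult_nonneg_nonneg order_trans)
qed

end

section \<open>Permutations\<close>

lemma prefix_set_Suc: "prefix_set \<pi> (Suc k) = insert (\<pi> (Suc k)) (prefix_set \<pi> k)"
  by (simp add: prefix_set_def atLeastAtMostSuc_conv)

lemma prefix_set_0: "prefix_set \<pi> 0 = {}"
  by (simp add: prefix_set_def)

lemma prefix_set_card:
  fixes \<pi> :: "nat \<Rightarrow> 'n::finite"
  shows "is_permutation \<pi> \<Longrightarrow> prefix_set \<pi> CARD('n) = UNIV"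
  by (simp add: prefix_set_def is_permutation_def bij_betw_def)

lemma permutation_notin_prefix_set:
  fixes \<pi> :: "nat \<Rightarrow> 'n::finite"
  assumes "is_permutation \<pi>" and "Suc k \<le> CARD('n)"
  shows "\<pi> (Suc k) \<notin> prefix_set \<pi> k"
proof
  assume "\<pi> (Suc k) \<in> prefix_set \<pi> k"
  then obtain l where "l \<in> {1..k}" "\<pi> (Suc k) = \<pi> l" by (auto simp: prefix_set_def)
  moreover have "inj_on \<pi> {1..CARD('n)}"
    using assms(1) by (simp add: is_permutation_def bij_betw_def)
  ultimately show False
    using assms(2) inj_onD[of \<pi> "{1..CARD('n)}" "Suc k" l] by auto
qed

lemma sorting_permutation:
  fixes z :: "real^'n"
  obtains \<pi> where "is_permutation \<pi>"
    and "\<And>j k. 1 \<le> j \<Longrightarrow> j \<le> k \<Longrightarrow> k \<le> CARD('n) \<Longrightarrow> z $ \<pi> k \<le> z $ \<pi> j"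
proof -
  obtain ys :: "'n list" where ys: "set ys = UNIV" "distinct ys"
    using finite_distinct_list[OF finite] by auto
  \<comment> \<open>The negated key makes the ascending sort decreasing in \<open>z\<close>. List
    positions start at 0 and permutations at 1, hence the shift in \<open>\<pi>\<close>.\<close>
  define xs where "xs = sort_key (\<lambda>i. - z $ i) ys"
  define \<pi> where "\<pi> k = xs ! (k - 1)" for k
  have xs: "set xs = UNIV" "distinct xs" "sorted (map (\<lambda>i. - z $ i) xs)"
    using ys by (auto simp: xs_def)
  then have len: "length xs = CARD('n)"
    by (metis distinct_card)
  have "bij_betw ((!) xs) {..<CARD('n)} UNIV"
    using bij_betw_nth[OF xs(2)] xs(1) len by auto
  moreover have "bij_betw (\<lambda>k. k - 1) {1..CARD('n)} {..<CARD('n)}"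
    by (rule bij_betw_byWitness[where f' = Suc]) auto
  ultimately have "is_permutation \<pi>"
    unfolding is_permutation_def \<pi>_def by (auto dest: bij_betw_trans simp: comp_def)
  moreover have "z $ \<pi> k \<le> z $ \<pi> j" if "1 \<le> j" "j \<le> k" "k \<le> CARD('n)" for j k
    using sorted_nth_mono[OF xs(3), of "j - 1" "k - 1"] that len by (simp add: \<pi>_def)
  ultimately show ?thesis by (rule that)
qed

text \<open>Abel summation: the sum is the left side plus the nonnegative terms
  \<open>(w k - w (Suc k)) * (h k - m)\<close> for \<open>k < n\<close>.\<close>

lemma sum_decreasing_weights_ge:
  fixes w h :: "nat \<Rightarrow> real"
  assumes "\<And>k. k < n \<Longrightarrow> w (Suc k) \<le> w k" and "\<And>k. k \<le> n \<Longrightarrow> m \<le> h k"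
  shows "w n * (h n - m) - w 0 * (h 0 - m) \<le> (\<Sum>k = 1..n. w k * (h k - h (k - 1)))"
  using assms
proof (induction n)
  case (Suc n)
  have "w (Suc n) * (h n - m) \<le> w n * (h n - m)"
    using Suc.prems by (intro mult_right_mono) auto
  moreover have "w n * (h n - m) - w 0 * (h 0 - m) \<le> (\<Sum>k = 1..n. w k * (h k - h (k - 1)))"
    using Suc by auto
  ultimately show ?case by (simp add: algebra_simps)
qed simp

text \<open>Build \<open>S\<close> in the order of \<open>\<pi>\<close>: each increment is taken
  over \<open>S\<close> intersected with a prefix, and supermodularity bounds it by the increment
  over the whole prefix. Elements outside \<open>S\<close> contribute zero.\<close>

lemma Qstar_le_sum_R:
  fixes Q :: "real^'n^'n"
  assumes Q: "stieltjes Q" and \<pi>: "is_permutation \<pi>"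
  shows "Qstar Q S \<le> (\<Sum>k = 1..CARD('n). ind S $ \<pi> k *\<^sub>R R Q (\<pi> k) (prefix_set \<pi> (k - 1)))"
proof -
  have "Qstar Q (S \<inter> prefix_set \<pi> n)
      \<le> (\<Sum>k = 1..n. ind S $ \<pi> k *\<^sub>R R Q (\<pi> k) (prefix_set \<pi> (k - 1)))"
    if "n \<le> CARD('n)" for n
    using that
  proof (induction n)
    case 0
    then show ?case by (simp add: prefix_set_0 Qstar_empty[OF stieltjes_sym[OF Q]])
  next
    case (Suc n)
    have "R Q (\<pi> (Suc n)) (S \<inter> prefix_set \<pi> n) \<le> R Q (\<pi> (Suc n)) (prefix_set \<pi> n)"
      using permutation_notin_prefix_set[OF \<pi> Suc.prems] by (intro R_mono[OF Q]) auto
    then show ?case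
      using Suc by (auto simp: prefix_set_Suc ind_def Qstar_insert intro!: add_mono)
  qed
  from this[of "CARD('n)"] show ?thesis by (simp add: prefix_set_card[OF \<pi>])
qed

section \<open>The two optimisation problems\<close>

text \<open>The minimum of the (MIQO) objective over all \<open>x\<close> supported in
  \<open>S\<close>, attained at \<open>- (1/2) *\<^sub>R (Qstar Q S *v a)\<close>.\<close>

definition support_value :: "real^'n^'n \<Rightarrow> real^'n \<Rightarrow> real^'n \<Rightarrow> 'n set \<Rightarrow> real" where
  "support_value Q a c S = c \<bullet> ind S - a \<bullet> (Qstar Q S *v a) / 4"

lemma miqo_objective_ge:
  fixes Q :: "real^'n^'n"
  assumes sym: "transpose Q = Q" and pd: "positive_definite Q"
    and "miqo_feasible (x, z)"
  shows "support_value Q a c {i. z $ i = 1} \<le> miqo_objective Q a c (x, z)"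
proof -
  define S where "S = {i. z $ i = 1}"
  let ?X = "Qstar Q S"
  note X = principal_inverse_Qstar[OF sym pd, of S]
  have x: "x $ i = 0" if "i \<notin> S" for i
    using assms(3) that by (auto simp: S_def)
  have z: "z = ind S"
    using assms(3) by (auto simp: S_def ind_def vec_eq_iff)
  \<comment> \<open>The deviation of \<open>x\<close> from the minimiser on the support
    \<open>S\<close>; its quadratic form is the excess of the objective over
    \<open>support_value\<close>.\<close>
  define y where "y = x + (1/2) *\<^sub>R (?X *v a)"
  have "0 \<le> y \<bullet> (Q *v y)"
    using pd by (cases "y = 0") (auto simp: positive_definite_def less_imp_le)
  also have "y \<bullet> (Q *v y) = x \<bullet> (Q *v x) + x \<bullet> (Q *v (?X *v a))
      + (?X *v a) \<bullet> (Q *v (?X *v a)) / 4"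
    unfolding y_def using inner_symmetric_matrix[OF sym, of "?X *v a" x]
    by (simp add: matrix_vector_right_distrib matrix_vector_mult_scaleR inner_add_left
        inner_add_right add_divide_distrib)
  finally show ?thesis
    using inner_principal_inverse[OF X x] principal_inverse_quadratic_form[OF X]
    by (simp add: support_value_def S_def[symmetric] z[symmetric] inner_commute)
qed

section \<open>Lower bound on (SDP)\<close>

lemma sum_UNIV_option:
  "(\<Sum>p\<in>UNIV. f p) = f None + (\<Sum>i\<in>UNIV. f (Some i))" for f :: "'n::finite option \<Rightarrow> real"
  by (simp add: UNIV_option_conv sum.reindex)

lemma bordered_quadratic_form:
  fixes u x :: "real^'n" and v :: "real^('n option)"
  assumes "\<And>i. v $ Some i = u $ i"
  shows "v \<bullet> (bordered W x t *v v) = u \<bullet> (W *v u) + 2 * v $ None * (u \<bullet> x) + (v $ None)\<^sup>2 * t"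
  by (simp add: inner_vec_def matrix_vector_mult_def bordered_def sum_UNIV_option assms
      distrib_left sum.distrib sum_distrib_left power2_eq_square algebra_simps)

lemma bordered_psd_lower_bound:
  assumes "bordered W x t \<in> psd_cone"
  shows "- (a \<bullet> (W *v a)) / 4 \<le> a \<bullet> x + t"
proof -
  \<comment> \<open>The factor 1/2 turns the doubled cross term into exactly
    \<open>a \<bullet> x\<close>, and the entry 1 at \<open>None\<close> keeps \<open>t\<close>
    unscaled.\<close>
  define v where "v = (\<chi> p. case p of None \<Rightarrow> 1 | Some i \<Rightarrow> ((1/2) *\<^sub>R a) $ i)"
  have "0 \<le> v \<bullet> (bordered W x t *v v)"
    using assms by (simp add: psd_cone_def positive_semidefinite_def)
  also have "\<dots> = ((1/2) *\<^sub>R a) \<bullet> (W *v ((1/2) *\<^sub>R a)) + 2 * v $ None * (((1/2) *\<^sub>R a) \<bullet> x)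
      + (v $ None)\<^sup>2 * t"
    by (rule bordered_quadratic_form) (simp add: v_def)
  finally show ?thesis by (simp add: v_def matrix_vector_mult_scaleR)
qed

text \<open>The sign condition on \<open>a\<close> makes all products of its entries nonnegative, so
  an entrywise bound on matrices passes to the quadratic form at \<open>a\<close>.\<close>

lemma quadratic_form_mono:
  fixes V W :: "real^'n^'n"
  assumes "V \<le> W" and "a \<le> 0 \<or> a \<ge> 0"
  shows "a \<bullet> (V *v a) \<le> a \<bullet> (W *v a)"
proof -
  have "0 \<le> a $ i * a $ j" for i j
    using assms(2) by (auto simp: less_eq_vec_def intro: mult_nonneg_nonneg mult_nonpos_nonpos)
  then have "V $ i $ j * (a $ i * a $ j) \<le> W $ i $ j * (a $ i * a $ j)" for i j
    using assms(1) by (intro mult_right_mono) (auto simp: less_eq_vec_def)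
  then show ?thesis
    by (auto simp: inner_vec_def matrix_vector_mult_def sum_distrib_left algebra_simps
        intro!: sum_mono)
qed

text \<open>This marginal change is the coefficient of \<open>z $ k\<close> once the permutation
  constraint replaces \<open>W\<close> in the lower bound.\<close>

lemma support_value_insert:
  assumes "k \<notin> S"
  shows "support_value Q a c (insert k S) - support_value Q a c S
    = c $ k - a \<bullet> (R Q k S *v a) / 4"
proof -
  have "ind (insert k S) = ind S + axis k 1"
    using assms by (auto simp: ind_def axis_def vec_eq_iff)
  then show ?thesis
    by (simp add: support_value_def R_def inner_add_right inner_axis
        matrix_vector_mult_diff_rdistrib inner_diff_right diff_divide_distrib)
qed

lemma quadratic_form_sum:
  fixes M :: "'b \<Rightarrow> real^'n^'n"
  shows "a \<bullet> ((\<Sum>k\<in>K. w k *\<^sub>R M k) *v a) = (\<Sum>k\<in>K. w k * (a \<bullet> (M k *v a)))"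
proof (induction K rule: infinite_finite_induct)
  case (insert k K)
  then show ?case
    by (simp add: matrix_vector_mult_add_rdistrib inner_add_right
        scaleR_matrix_vector_assoc[symmetric])
qed auto

lemma sdp_objective_ge:
  fixes Q :: "real^'n^'n"
  assumes Q: "stieltjes Q" and a: "a \<le> 0 \<or> a \<ge> 0"
    and feas: "sdp_feasible Q (x, z, W, t)"
    and m: "\<And>S. m \<le> support_value Q a c S"
  shows "m \<le> sdp_objective a c (x, z, W, t)"
proof -
  obtain \<pi> where \<pi>: "is_permutation \<pi>"
    and mono: "\<And>j k. 1 \<le> j \<Longrightarrow> j \<le> k \<Longrightarrow> k \<le> CARD('n) \<Longrightarrow> z $ \<pi> k \<le> z $ \<pi> j"
    using sorting_permutation[of z] by blast
  define n where "n = CARD('n)"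
  \<comment> \<open>The value 1 at index 0 extends the decreasing sequence, as \<open>z\<close> is
    at most 1. Together with \<open>h 0 = 0\<close> it makes the boundary term at 0 contribute
    exactly \<open>m\<close>.\<close>
  define w where "w k = (if k = 0 then 1 else z $ \<pi> k)" for k
  define h where "h k = support_value Q a c (prefix_set \<pi> k)" for k
  have z: "0 \<le> z $ i" "z $ i \<le> 1" for i using feas by auto
  have "w n * (h n - m) - w 0 * (h 0 - m) \<le> (\<Sum>k = 1..n. w k * (h k - h (k - 1)))"
    using z mono m by (intro sum_decreasing_weights_ge) (auto simp: w_def h_def n_def)
  moreover have "0 \<le> w n * (h n - m)"
    using z m by (auto simp: w_def h_def)
  moreover have "h 0 = 0"
    by (simp add: h_def support_value_def prefix_set_0 Qstar_empty[OF stieltjes_sym[OF Q]] ind_def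
        inner_vec_def)
  ultimately have "m \<le> (\<Sum>k = 1..n. w k * (h k - h (k - 1)))"
    by (simp add: w_def)
  also have "\<dots> = (\<Sum>k = 1..n. z $ \<pi> k * c $ \<pi> k
      - z $ \<pi> k * (a \<bullet> (R Q (\<pi> k) (prefix_set \<pi> (k - 1)) *v a)) / 4)"
  proof (rule sum.cong)
    fix k assume k: "k \<in> {1..n}"
    then obtain l where l: "k = Suc l" by (cases k) auto
    then have "\<pi> k \<notin> prefix_set \<pi> l"
      using permutation_notin_prefix_set[OF \<pi>] k by (auto simp: n_def)
    then have "h k - h (k - 1) = c $ \<pi> k - a \<bullet> (R Q (\<pi> k) (prefix_set \<pi> (k - 1)) *v a) / 4"
      using support_value_insert by (simp add: h_def l prefix_set_Suc)
    then show "w k * (h k - h (k - 1)) = z $ \<pi> k * c $ \<pi> k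
      - z $ \<pi> k * (a \<bullet> (R Q (\<pi> k) (prefix_set \<pi> (k - 1)) *v a)) / 4"
      using l by (simp add: w_def right_diff_distrib)
  qed simp
  also have "\<dots> = c \<bullet> z
      - a \<bullet> ((\<Sum>k = 1..n. z $ \<pi> k *\<^sub>R R Q (\<pi> k) (prefix_set \<pi> (k - 1))) *v a) / 4"
  proof -
    have "(\<Sum>k = 1..n. z $ \<pi> k * c $ \<pi> k) = c \<bullet> z"
      unfolding inner_vec_def n_def
      using sum.reindex_bij_betw[OF \<pi>[unfolded is_permutation_def], of "\<lambda>i. z $ i * c $ i"]
      by (simp add: mult.commute)
    then show ?thesis
      by (simp add: quadratic_form_sum sum_subtractf sum_divide_distrib)
  qed
  \<comment> \<open>The constraint on \<open>W\<close> enters for the sorting permutation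
    alone.\<close>
  also have "\<dots> \<le> c \<bullet> z - a \<bullet> (W *v a) / 4"
    using quadratic_form_mono[OF _ a] feas \<pi> by (auto simp: n_def)
  also have "\<dots> \<le> sdp_objective a c (x, z, W, t)"
    using bordered_psd_lower_bound[of W x t a] feas by simp
  finally show ?thesis .
qed

section \<open>A feasible point of (SDP) for every support\<close>

lemma Qstar_sdp_feasible:
  fixes Q :: "real^'n^'n"
  assumes Q: "stieltjes Q"
  shows "sdp_feasible Q (- (1/2) *\<^sub>R (Qstar Q S *v a), ind S, Qstar Q S, a \<bullet> (Qstar Q S *v a) / 4)"
proof -
  let ?X = "Qstar Q S"
  let ?x = "- (1/2) *\<^sub>R (?X *v a)" and ?t = "a \<bullet> (?X *v a) / 4"
  have tX: "transpose ?X = ?X"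
    using principal_inverse_Qstar[OF stieltjes_sym[OF Q] stieltjes_pd[OF Q]]
    by (simp add: principal_inverse_def)
  have "0 \<le> v \<bullet> (bordered ?X ?x ?t *v v)" for v
  proof -
    define u where "u = (\<chi> i. v $ Some i)"
    define s where "s = v $ None"
    have "v \<bullet> (bordered ?X ?x ?t *v v) = u \<bullet> (?X *v u) + 2 * s * (u \<bullet> ?x) + s\<^sup>2 * ?t"
      unfolding s_def by (rule bordered_quadratic_form) (simp add: u_def)
    \<comment> \<open>Completing the square: \<open>?x\<close> and \<open>?t\<close> are exactly the
      cross term and the constant term that it requires.\<close>
    also have "\<dots> = (u - (s/2) *\<^sub>R a) \<bullet> (?X *v (u - (s/2) *\<^sub>R a))"
      using inner_symmetric_matrix[OF tX, of a u]
      by (simp add: matrix_vector_mult_diff_distrib matrix_vector_mult_scaleR inner_diff_left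
          inner_diff_right power2_eq_square algebra_simps)
    finally show ?thesis using Qstar_psd[OF stieltjes_sym[OF Q] stieltjes_pd[OF Q]] by simp
  qed
  moreover have "transpose (bordered ?X ?x ?t) = bordered ?X ?x ?t"
    using transpose_eq_nth[OF tX]
    by (auto simp: transpose_def bordered_def vec_eq_iff split: option.split)
  ultimately have "bordered ?X ?x ?t \<in> psd_cone"
    by (simp add: psd_cone_def positive_semidefinite_def)
  then show ?thesis
    using Qstar_le_sum_R[OF Q] Qstar_psd[OF stieltjes_sym[OF Q] stieltjes_pd[OF Q]]
    by (auto simp: ind_def)
qed

theorem proposition4:
  fixes Q :: "real^'n^'n" and a c :: "real^'n"
  assumes "stieltjes Q"
    and "a \<le> 0 \<or> a \<ge> 0"
  shows "\<exists>x z W t.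
    is_arg_min (sdp_objective a c) (sdp_feasible Q) (x, z, W, t) \<and>
    is_arg_min (miqo_objective Q a c) miqo_feasible (x, z) \<and>
    sdp_objective a c (x, z, W, t) = miqo_objective Q a c (x, z)"
proof -
  note sym = stieltjes_sym[OF assms(1)] and pd = stieltjes_pd[OF assms(1)]
  let ?g = "support_value Q a c"
  obtain S where S: "?g S \<le> ?g T" for T
    using ex_min_if_finite[of "range ?g"] by (auto simp: not_less)
  let ?X = "Qstar Q S"
  \<comment> \<open>\<open>?x\<close> solves 2 Q x + a = 0 on the rows in \<open>S\<close>, and
    \<open>?t\<close> is the value of its quadratic form under \<open>Q\<close>, so both objectives
    agree.\<close>
  let ?x = "- (1/2) *\<^sub>R (?X *v a)" and ?t = "a \<bullet> (?X *v a) / 4"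
  note X = principal_inverse_Qstar[OF sym pd, of S]
  have sdp: "sdp_objective a c (?x, ind S, ?X, ?t) = ?g S"
    by (simp add: support_value_def)
  have miqo: "miqo_objective Q a c (?x, ind S) = ?g S"
    using principal_inverse_quadratic_form[OF X, of a]
      matrix_vector_mult_scaleR[of Q "- (1/2)" "?X *v a"]
    by (simp add: support_value_def)
  have miqo_feas: "miqo_feasible (?x, ind S)"
    using principal_inverse_vec_nth_eq_0[OF X] by (auto simp: ind_def)
  have "?g S \<le> miqo_objective Q a c p" if "miqo_feasible p" for p
    using that S miqo_objective_ge[OF sym pd] by (cases p) (blast intro: order_trans)
  with miqo_feas have "is_arg_min (miqo_objective Q a c) miqo_feasible (?x, ind S)"
    unfolding is_arg_min_linorder miqo by blast
  moreover have "is_arg_min (sdp_objective a c) (sdp_feasible Q) (?x, ind S, ?X, ?t)"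
    unfolding is_arg_min_linorder sdp
    using Qstar_sdp_feasible[OF assms(1)] sdp_objective_ge[OF assms _ S] by auto
  ultimately show ?thesis
    using sdp miqo by metis
qed

end
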